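(* Let $\mathcal{O}$ be an o-minimal structure on $(\mathbb{R},+,\cdot)$, let $\Omega\subset\mathbb{R}^N$ be an open set with $0\in\Omega$, and let $G:\Omega\to\mathbb{R}$ be a $C^2$ function definable in $\mathcal{O}$. Assume that $G(0)=0$ and that $0$ is a nontrivial critical point of $G$. Let $\eta,r_0>0$ and let $\varphi:[0,r_0)\to\mathbb{R}_+$ be a desingularizing function of $G$ at $0$ on $B(0,\eta)$, so that in particular $$\|\nabla(\varphi\circ|G|)(u)\|\ge 1\quad\text{for every }u\in B(0,\eta)\text{ with }G(u)\ne 0.$$ Then there exists $c>0$ such that $\varphi'(s)\ge \dfrac{c}{\sqrt{s}}$, so that $\varphi(s)\ge 2c\sqrt{s}$, for every sufficiently small $s>0$.
   Context: $B(\bar u,\eta)$ is the open Euclidean ball of center $\bar u$ and radius $\eta$ in $\mathbb{R}^N$. Desingularizing function: for a differentiable real-valued function $G$ on (an open subset of) $\mathbb{R}^N$ and a point $\bar u$ of its domain, a function $\varphi\in C([0,r_0);\mathbb{R}_+)$ ($r_0>0$) is a desingularizing function of $G$ at $\bar u$ on $B(\bar u,\eta)$ ($\eta>0$, the ball contained in the domain) if: $\varphi(0)=0$, $\varphi$ is $C^1$ on $(0,r_0)$, concave, and $\varphi'>0$ on $(0,r_0)$; $|G(u)-G(\bar u)|<r_0$ for all $u\in B(\bar u,\eta)$; and $\|\nabla(\varphi\circ|G(\cdot)-G(\bar u)|)(u)\|\ge1$ for every $u\in B(\bar u,\eta)$ with $G(u)\ne G(\bar u)$. (By the Kurdyka-Łojasiewicz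 theorem, such $\varphi$ exists for definable $C^1$ functions.) A critical point $u$ of $G$ is trivial if it lies in the interior of the set of critical points $\operatorname{crit}G=\{\nabla G=0\}$, and nontrivial otherwise; equivalently, $u$ is nontrivial if there is a sequence $u_n\to u$ with $G(u_n)\neq G(u)$ for all $n$. O-minimal structure on $(\mathbb{R},+,\cdot)$: a sequence $\mathcal{O}=\{\mathcal{O}_n\}_{n\in\mathbb{N}}$, each $\mathcal{O}_n$ a Boolean algebra of subsets of $\mathbb{R}^n$, such that for each $n$: (i) $A\in\mathcal{O}_n$ implies $A\times\mathbb{R},\ \mathbb{R}\times A\in\mathcal{O}_{n+1}$; (ii) if $\Pi:\mathbb{R}^{n+1}\to\mathbb{R}^n$ is the canonical projection and $A\in\mathcal{O}_{n+1}$, then $\Pi(A)\in\mathcal{O}_n$; (iii) $\mathcal{O}_n$ contains every set $\{x\in\mathbb{R}^n;p(x)=0\}$ with $p$ a real polynomial; (iv) the elements of $\mathcal{O}_1$ are exactly the finite unions of intervals and points. A set $A\subset\mathbb{R}^n$ is definable if $A\in\mathcal{O}_n$; a map is definable if its graph is definable. *)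

theory Defs
  imports "HOL-Analysis.Analysis"
begin

text \<open>
  An o-minimal structure involves all the spaces $R^n$ at once, so there the points of $R^n$ are
  the real lists of length \<open>n\<close>. The type \<open>real ^ 'n\<close> is used for the space on which the function
  \<open>G\<close> of the theorem lives.
\<close>

definition Rn :: "nat \<Rightarrow> real list set" where
  "Rn n = {x. length x = n}"

text \<open>The real polynomials in \<open>n\<close> variables, as functions on \<open>Rn n\<close>
  (cf. \<open>real_polynomial_function\<close>).\<close>

inductive polynomial_fun :: "nat \<Rightarrow> (real list \<Rightarrow> real) \<Rightarrow> bool" for n :: nat where
  const: "polynomial_fun n (\<lambda>x. c)"
| coord: "i < n \<Longrightarrow> polynomial_fun n (\<lambda>x. x ! i)"
| add: "polynomial_fun n p \<Longrightarrow> polynomial_fun n q \<Longrightarrow> polynomial_fun n (\<lambda>x. p x + q x)"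
| mult: "polynomial_fun n p \<Longrightarrow> polynomial_fun n q \<Longrightarrow> polynomial_fun n (\<lambda>x. p x * q x)"

text \<open>In the last clause, \<open>is_interval\<close> allows bounded and unbounded intervals with or without
  their endpoints, including the degenerate intervals \<open>{a}\<close>.\<close>

definition o_minimal_structure :: "(nat \<Rightarrow> real list set set) \<Rightarrow> bool" where
  "o_minimal_structure \<O> \<longleftrightarrow>
     (\<forall>n. algebra (Rn n) (\<O> n)) \<and>
     (\<forall>n. \<forall>A \<in> \<O> n. {x @ [t] | x t. x \<in> A} \<in> \<O> (Suc n) \<and> {t # x | t x. x \<in> A} \<in> \<O> (Suc n)) \<and>
     (\<forall>n. \<forall>A \<in> \<O> (Suc n). butlast ` A \<in> \<O> n) \<and>
     (\<forall>n p. polynomial_fun n p \<longrightarrow> {x \<in> Rn n. p x = 0} \<in> \<O> n) \<and>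
     \<O> 1 = {(\<lambda>t. [t]) ` \<Union>F | F :: real set set. finite F \<and> (\<forall>I \<in> F. is_interval I)}"

text \<open>The coordinates of a vector, listed in the order of its index type.\<close>

definition coords :: "real ^ 'n::{finite,linorder} \<Rightarrow> real list" where
  "coords x = map (($) x) (sorted_list_of_set UNIV)"

definition definable_on ::
    "(nat \<Rightarrow> real list set set) \<Rightarrow> (real ^ 'n::{finite,linorder}) set \<Rightarrow> (real ^ 'n::{finite,linorder} \<Rightarrow> real) \<Rightarrow> bool"
  where
  "definable_on \<O> \<Omega> G \<longleftrightarrow> {coords x @ [G x] | x. x \<in> \<Omega>} \<in> \<O> (Suc CARD('n))"

text \<open>\<open>C2_on\<close> is meant for open sets. Continuity of the gradient \<open>g\<close> follows from its
  differentiability.\<close>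

definition C2_on :: "'a::euclidean_space set \<Rightarrow> ('a \<Rightarrow> real) \<Rightarrow> bool" where
  "C2_on \<Omega> G \<longleftrightarrow>
     (\<exists>(g :: 'a \<Rightarrow> 'a) (H :: 'a \<Rightarrow> 'a \<Rightarrow>\<^sub>L 'a).
        (\<forall>x\<in>\<Omega>. GDERIV G x :> g x) \<and>
        (\<forall>x\<in>\<Omega>. (g has_derivative blinfun_apply (H x)) (at x)) \<and>
        continuous_on \<Omega> H)"

definition crit :: "'a::euclidean_space set \<Rightarrow> ('a \<Rightarrow> real) \<Rightarrow> 'a set" where
  "crit \<Omega> G = {u \<in> \<Omega>. GDERIV G u :> 0}"

definition nontrivial_critical_point ::
    "'a::euclidean_space set \<Rightarrow> ('a \<Rightarrow> real) \<Rightarrow> 'a \<Rightarrow> bool" where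
  "nontrivial_critical_point \<Omega> G u \<longleftrightarrow> u \<in> crit \<Omega> G \<and> u \<notin> interior (crit \<Omega> G)"

text \<open>\<open>\<phi>\<close> is only relevant on \<open>[0, r\<^sub>0)\<close>. In the last clause, the gradient exists since
  \<open>|G u - G a|\<close> lies in \<open>(0, r\<^sub>0)\<close>, where \<open>\<phi>\<close> is differentiable.\<close>

definition desingularizing_function ::
    "'a::euclidean_space set \<Rightarrow> ('a \<Rightarrow> real) \<Rightarrow> 'a \<Rightarrow> real \<Rightarrow> real \<Rightarrow> (real \<Rightarrow> real) \<Rightarrow> bool" where
  "desingularizing_function \<Omega> G a \<eta> r\<^sub>0 \<phi> \<longleftrightarrow>
     0 < r\<^sub>0 \<and> 0 < \<eta> \<and> ball a \<eta> \<subseteq> \<Omega> \<and>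
     continuous_on {0..<r\<^sub>0} \<phi> \<and> (\<forall>s\<in>{0..<r\<^sub>0}. 0 \<le> \<phi> s) \<and> \<phi> 0 = 0 \<and>
     \<phi> C1_differentiable_on {0<..<r\<^sub>0} \<and> concave_on {0..<r\<^sub>0} \<phi> \<and>
     (\<forall>s\<in>{0<..<r\<^sub>0}. 0 < deriv \<phi> s) \<and>
     (\<forall>u\<in>ball a \<eta>. \<bar>G u - G a\<bar> < r\<^sub>0) \<and>
     (\<forall>u\<in>ball a \<eta>. G u \<noteq> G a \<longrightarrow>
        (\<exists>D. (GDERIV (\<lambda>v. \<phi> \<bar>G v - G a\<bar>) u :> D) \<and> 1 \<le> norm D))"

end

theory Submission
  imports Defs
begin

text \<open>
  Fix a small \<open>s > 0\<close> and let \<open>u\<close> be a point of least norm with \<open>\<bar>G u\<bar> \<ge> s\<close>. Then \<open>\<bar>G u\<bar> = s\<close>, and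
  \<open>u\<close> maximizes \<open>\<bar>G\<bar>\<close> on the closed ball of radius \<open>norm u\<close>, so the gradient \<open>\<nabla>G u\<close> is radial. If
  \<open>L\<close> is a Lipschitz constant of the gradient, a descent step \<open>u - \<nabla>\<bar>G\<bar> u / (2 L)\<close>, which points towards the
  origin, stays in this ball and decreases \<open>sgn (G u) * G\<close> by at least \<open>(norm (\<nabla>G u))\<^sup>2 / (4 L)\<close>,
  while it cannot decrease by more than \<open>2 s\<close> there. Hence \<open>(norm (\<nabla>G u))\<^sup>2 \<le> 8 L s\<close>, and the
  desingularization inequality at \<open>u\<close> is the desired bound at \<open>s\<close>.
\<close>

section \<open>Gradients at a maximum over a ball centred at the origin\<close>

lemma GDERIV_line:
  fixes F :: "'a::real_inner \<Rightarrow> real"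
  assumes "GDERIV F (x + t *\<^sub>R w) :> g"
  shows "((\<lambda>t. F (x + t *\<^sub>R w)) has_real_derivative w \<bullet> g) (at t)"
proof -
  have "((\<lambda>t. x + t *\<^sub>R w) has_derivative (\<lambda>h. h *\<^sub>R w)) (at t)"
    by (auto intro!: derivative_eq_intros)
  from has_derivative_compose[OF this assms[unfolded gderiv_def]]
  show ?thesis
    by (simp add: has_field_derivative_def mult_commute_abs)
qed

lemma gderiv_unique:
  fixes F :: "'a::real_inner \<Rightarrow> real"
  assumes "GDERIV F x :> D" "GDERIV F x :> E"
  shows "D = E"
proof -
  have "(\<lambda>h. h \<bullet> D) = (\<lambda>h. h \<bullet> E)"
    using assms unfolding gderiv_def by (rule has_derivative_unique)
  then have "(D - E) \<bullet> D = (D - E) \<bullet> E" by metis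
  then have "(D - E) \<bullet> (D - E) = 0" by (simp add: inner_diff_right)
  then show ?thesis by simp
qed

text \<open>A Lagrange multiplier rule: a direction \<open>w\<close> with
  \<open>w \<bullet> u < 0\<close> enters the ball, so \<open>F\<close> cannot increase along it.
  Taking \<open>- u\<close> gives the sign of \<open>l\<close>; the tangential part \<open>p\<close>
  of \<open>g\<close>, tilted inward, shows that \<open>p\<close> vanishes.\<close>

lemma gradient_radial_at_max:
  fixes F :: "'a::real_inner \<Rightarrow> real"
  assumes F: "GDERIV F u :> g" and u: "u \<noteq> 0"
    and max: "\<And>v. norm v \<le> norm u \<Longrightarrow> F v \<le> F u"
  obtains l where "0 \<le> l" "g = l *\<^sub>R u"
proof -
  have inward: "w \<bullet> g \<le> 0" if w: "w \<bullet> u < 0" for w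
  proof (rule ccontr)
    assume "\<not> w \<bullet> g \<le> 0"
    moreover have "((\<lambda>t. F (u + t *\<^sub>R w)) has_real_derivative w \<bullet> g) (at 0)"
      using F by (intro GDERIV_line) simp
    ultimately obtain d where d: "d > 0" "\<And>h. 0 < h \<Longrightarrow> h < d \<Longrightarrow> F u < F (u + h *\<^sub>R w)"
      using DERIV_pos_inc_right[of "\<lambda>t. F (u + t *\<^sub>R w)" "w \<bullet> g" 0] by auto
    have w0: "w \<bullet> w > 0" using w by auto
    \<comment> \<open>The first bound ensures that \<open>F\<close> increases; the second, after
      expanding the square of the norm, that the point stays in the ball.\<close>
    define t where "t = min (d / 2) (- 2 * (w \<bullet> u) / (w \<bullet> w))"
    have t: "0 < t" "t < d" "t \<le> - 2 * (w \<bullet> u) / (w \<bullet> w)"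
      using d(1) divide_neg_pos[OF w w0] by (auto simp: t_def)
    have "t * (w \<bullet> w) \<le> - 2 * (w \<bullet> u)"
      using t(3) w0 by (simp only: pos_le_divide_eq)
    then have "t * (t * (w \<bullet> w)) \<le> t * (- 2 * (w \<bullet> u))"
      using t(1) by (intro mult_left_mono) auto
    then have "norm (u + t *\<^sub>R w) \<le> norm u"
      by (simp add: norm_le inner_add_left inner_add_right inner_commute)
    then have "F (u + t *\<^sub>R w) \<le> F u" by (rule max)
    with d(2)[OF t(1,2)] show False by simp
  qed
  define l where "l = (u \<bullet> g) / (u \<bullet> u)"
  have uu: "u \<bullet> u > 0" using u by simp
  have ug: "u \<bullet> g \<ge> 0" using inward[of "- u"] uu by simp
  define p where "p = g - l *\<^sub>R u"
  have pu: "p \<bullet> u = 0"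
    using uu by (simp add: p_def l_def inner_diff_left inner_commute[of g u])
  have pg: "p \<bullet> g = p \<bullet> p"
    using pu by (simp add: p_def inner_diff_right)
  \<comment> \<open>\<open>inward\<close> needs a strictly inward direction and \<open>p\<close> is
    only tangent, hence the tilt by \<open>k *\<^sub>R u\<close>. The summand 1 in \<open>k\<close>
    covers the case \<open>u \<bullet> g = 0\<close>.\<close>
  have "p \<bullet> p \<le> 0 + e" if "e > 0" for e
  proof -
    define k where "k = e / (u \<bullet> g + 1)"
    have k: "k > 0" using that ug by (simp add: k_def)
    have "(p - k *\<^sub>R u) \<bullet> g \<le> 0"
      using k uu pu by (intro inward) (simp add: inner_diff_left)
    then have "p \<bullet> p \<le> k * (u \<bullet> g)"
      using pg by (simp add: inner_diff_left)
    also have "\<dots> \<le> e"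
      using that ug by (simp add: k_def field_simps)
    finally show ?thesis by simp
  qed
  then have "p \<bullet> p \<le> 0" by (rule field_le_epsilon)
  then have "p = 0" by (metis inner_gt_zero_iff not_less)
  then have "g = l *\<^sub>R u" by (simp add: p_def)
  moreover have "0 \<le> l" using ug by (simp add: l_def)
  ultimately show thesis by (intro that)
qed

text \<open>The hypothesis \<open>max\<close> serves twice: it makes the gradient at
  \<open>u\<close> radial, and it bounds the drop \<open>F u - F v\<close> by
  \<open>2 * F u\<close>. Radiality keeps the descent step in the ball, the only place where
  \<open>F\<close> is controlled.\<close>

lemma norm_gradient_le_at_max:
  fixes F :: "'a::real_inner \<Rightarrow> real"
  assumes F: "\<And>x. norm x \<le> norm u \<Longrightarrow> GDERIV F x :> g x"
    and L: "L > 0"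
    and lip: "\<And>x y. norm x \<le> norm u \<Longrightarrow> norm y \<le> norm u \<Longrightarrow> norm (g x - g y) \<le> L * norm (x - y)"
    and g0: "g 0 = 0"
    and max: "\<And>v. norm v \<le> norm u \<Longrightarrow> \<bar>F v\<bar> \<le> F u"
  shows "(norm (g u))\<^sup>2 \<le> 8 * L * F u"
proof (cases "u = 0")
  case True
  then show ?thesis using g0 L max[of 0] by simp
next
  case u: False
  obtain l where l: "0 \<le> l" "g u = l *\<^sub>R u"
    using gradient_radial_at_max[OF F[OF order_refl] u abs_le_D1[OF max]] by blast
  \<comment> \<open>The gradient vanishes at 0, so the Lipschitz bound limits \<open>l\<close>. Thus
    the step scales \<open>u\<close> by a factor between 1/2 and 1.\<close>
  have "l * norm u \<le> L * norm u"
    using lip[of u 0] l g0 by simp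
  then have lL: "l \<le> L" using u by simp
  define w where "w = (1 / (2 * L)) *\<^sub>R g u"
  define v where "v = u - w"
  have v: "v = (1 - l / (2 * L)) *\<^sub>R u"
    by (simp add: v_def w_def l(2) algebra_simps)
  have "0 \<le> l / (2 * L)" "l / (2 * L) \<le> 1"
    using l(1) lL L by auto
  then have "\<bar>1 - l / (2 * L)\<bar> \<le> 1" by simp
  then have vn: "norm v \<le> norm u"
    unfolding v norm_scaleR by (intro mult_left_le_one_le) auto
  have seg: "norm (v + t *\<^sub>R w) \<le> norm u" if "0 \<le> t" "t \<le> 1" for t
  proof -
    have "v + t *\<^sub>R w = (1 - t) *\<^sub>R v + t *\<^sub>R u"
      by (simp add: v_def algebra_simps)
    moreover have "convex (cball (0::'a) (norm u))" by simp
    ultimately show ?thesis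
      using that vn convexD[of "cball 0 (norm u)" v u "1 - t" t] by simp
  qed
  obtain t where t: "0 < t" "t < 1"
      "F (v + 1 *\<^sub>R w) - F (v + 0 *\<^sub>R w) = (1 - 0) * (w \<bullet> g (v + t *\<^sub>R w))"
    using MVT2[of 0 1 "\<lambda>t. F (v + t *\<^sub>R w)" "\<lambda>t. w \<bullet> g (v + t *\<^sub>R w)"]
      GDERIV_line[OF F[OF seg]] by auto
  let ?x = "v + t *\<^sub>R w"
  have xu: "?x - u = (t - 1) *\<^sub>R w" by (simp add: v_def algebra_simps)
  \<comment> \<open>The step size \<open>1 / (2 * L)\<close> is chosen so that the gradient changes
    by at most half of its norm along the segment.\<close>
  have "norm (g ?x - g u) \<le> L * norm (?x - u)"
    using t seg[of t] by (intro lip) auto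
  also have "\<dots> \<le> L * norm w"
    unfolding xu norm_scaleR using t L by (intro mult_left_mono mult_left_le_one_le) auto
  also have "\<dots> = norm (g u) / 2" using L by (simp add: w_def)
  finally have le: "norm (g ?x - g u) \<le> norm (g u) / 2" .
  have "(norm (g u))\<^sup>2 / 2 = (norm (g u))\<^sup>2 - norm (g u) * (norm (g u) / 2)"
    by (simp add: power2_eq_square)
  also have "\<dots> \<le> (norm (g u))\<^sup>2 - norm (g u) * norm (g ?x - g u)"
    by (intro diff_left_mono mult_left_mono le norm_ge_zero)
  also have "\<dots> \<le> (norm (g u))\<^sup>2 + g u \<bullet> (g ?x - g u)"
    using Cauchy_Schwarz_ineq2[of "g u" "g ?x - g u"] by linarith
  also have "\<dots> = g u \<bullet> g ?x"
    by (simp add: inner_diff_right power2_norm_eq_inner)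
  also have "\<dots> = 2 * L * (w \<bullet> g ?x)"
    using L by (simp add: w_def)
  also have "\<dots> = 2 * L * (F u - F v)"
    using t(3) by (simp add: v_def)
  also have "\<dots> \<le> 2 * L * (2 * F u)"
    using max[OF vn] L by (intro mult_left_mono) auto
  finally show ?thesis by simp
qed

section \<open>Level points and local properties of \<open>G\<close>\<close>

text \<open>Minimize the norm on the compact set where \<open>\<bar>G v\<bar> \<ge> s\<close>.
  Strictly closer points have \<open>\<bar>G v\<bar> < s\<close>, and continuity carries
  \<open>\<le>\<close> to the closed ball, so to \<open>u\<close> itself.\<close>

lemma exists_level_point_maximal_on_cball:
  fixes G :: "'a::euclidean_space \<Rightarrow> real"
  assumes cont: "continuous_on (cball 0 d) G"
    and G0: "G 0 = 0" and p: "norm p \<le> d" "s \<le> \<bar>G p\<bar>" and s: "0 < s"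
  obtains u where "norm u \<le> d" "\<bar>G u\<bar> = s" "\<And>v. norm v \<le> norm u \<Longrightarrow> \<bar>G v\<bar> \<le> s"
proof -
  define K where "K = {v \<in> cball 0 d. \<bar>G v\<bar> \<in> {s..}}"
  have "compact K"
  proof -
    have "closed K"
      unfolding K_def
      using continuous_closed_preimage[OF continuous_on_rabs[OF cont] closed_cball, of "{s..}"]
      by (simp add: vimage_def Int_def)
    moreover have "K \<subseteq> cball 0 d" by (auto simp: K_def)
    ultimately show ?thesis
      by (metis compact_cball compact_Int_closed inf.absorb_iff2)
  qed
  moreover have "K \<noteq> {}" using p by (auto simp: K_def)
  ultimately obtain u where u: "u \<in> K" "\<And>v. v \<in> K \<Longrightarrow> norm u \<le> norm v"
    using continuous_attains_inf[of K norm] continuous_on_norm_id by blast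
  have ud: "norm u \<le> d" and us: "s \<le> \<bar>G u\<bar>" using u(1) by (auto simp: K_def)
  \<comment> \<open>The closure of the open ball is the closed ball only for positive
    radius.\<close>
  have u0: "0 < norm u" using us G0 s by auto
  have less: "\<bar>G v\<bar> < s" if "v \<in> ball 0 (norm u)" for v
    using u(2)[of v] that ud by (force simp: K_def)
  have le: "\<bar>G v\<bar> \<le> s" if "norm v \<le> norm u" for v
  proof (rule continuous_le_on_closure[of "ball 0 (norm u)" "\<lambda>v. \<bar>G v\<bar>"])
    show "continuous_on (closure (ball 0 (norm u))) (\<lambda>v. \<bar>G v\<bar>)"
      using ud u0 by (intro continuous_on_rabs continuous_on_subset[OF cont]) auto
    show "v \<in> closure (ball 0 (norm u))" using that u0 by simp
    show "\<And>x. x \<in> ball 0 (norm u) \<Longrightarrow> \<bar>G x\<bar> \<le> s" using less by fastforce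
  qed
  show thesis
    using that[OF ud _ le] us le[of u] by fastforce
qed

text \<open>If \<open>G\<close> vanished near \<open>u\<close>, so would its gradient, making
  \<open>u\<close> interior to the critical set.\<close>

lemma nontrivial_critical_point_nonzero_nearby:
  assumes "open \<Omega>" and "nontrivial_critical_point \<Omega> G u" and "0 < d"
  obtains p where "dist u p < d" "G p \<noteq> 0"
proof (rule ccontr)
  assume "\<not> thesis"
  then have zero: "\<forall>p\<in>ball u d. G p = 0" using that by force
  have u: "u \<in> \<Omega>" "u \<notin> interior (crit \<Omega> G)"
    using assms(2) by (auto simp: nontrivial_critical_point_def crit_def)
  let ?U = "ball u d \<inter> \<Omega>"
  have U: "open ?U" "u \<in> ?U" using assms u by auto
  have "GDERIV G x :> 0" if "x \<in> ?U" for x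
    unfolding gderiv_def
    by (rule has_derivative_transform_within_open[where f = "\<lambda>_. 0" and s = ?U]) (use that U zero in auto)
  then have "?U \<subseteq> crit \<Omega> G" by (auto simp: crit_def)
  with U have "u \<in> interior (crit \<Omega> G)" by (meson interiorI)
  with u show False by simp
qed

text \<open>The continuous Hessian is bounded on a compact ball, whose convexity allows the mean
  value inequality.\<close>

lemma C2_on_locally_Lipschitz_gradient:
  fixes G :: "'a::euclidean_space \<Rightarrow> real"
  assumes "C2_on \<Omega> G" "open \<Omega>" "a \<in> \<Omega>"
  obtains g d L where "0 < d" "cball a d \<subseteq> \<Omega>" "0 < L"
    "\<And>x. x \<in> \<Omega> \<Longrightarrow> GDERIV G x :> g x"
    "\<And>x y. x \<in> cball a d \<Longrightarrow> y \<in> cball a d \<Longrightarrow> norm (g x - g y) \<le> L * norm (x - y)"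
proof -
  obtain g and H :: "'a \<Rightarrow> 'a \<Rightarrow>\<^sub>L 'a" where
    g: "\<And>x. x \<in> \<Omega> \<Longrightarrow> GDERIV G x :> g x" and
    H: "\<And>x. x \<in> \<Omega> \<Longrightarrow> (g has_derivative blinfun_apply (H x)) (at x)" and
    cH: "continuous_on \<Omega> H"
    using assms(1) by (auto simp: C2_on_def)
  obtain d where d: "0 < d" "cball a d \<subseteq> \<Omega>"
    using assms open_contains_cball by blast
  have "compact (H ` cball a d)"
    using cH d by (intro compact_continuous_image continuous_on_subset[OF cH]) auto
  then obtain L where L: "0 < L" "\<And>x. x \<in> cball a d \<Longrightarrow> norm (H x) \<le> L"
    by (metis bounded_pos compact_imp_bounded imageI)
  show thesis
  proof (rule that[OF d L(1) g])
    fix x y assume xy: "x \<in> cball a d" "y \<in> cball a d"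
    show "norm (g x - g y) \<le> L * norm (x - y)"
    proof (rule differentiable_bound[of "cball a d" g "\<lambda>x. blinfun_apply (H x)"])
      fix z assume z: "z \<in> cball a d"
      show "(g has_derivative blinfun_apply (H z)) (at z within cball a d)"
        using H z d has_derivative_at_withinI by blast
      show "onorm (blinfun_apply (H z)) \<le> L"
        using L(2)[OF z] by (simp add: norm_blinfun.rep_eq)
    qed (use xy in auto)
  qed
qed

section \<open>From the desingularization inequality to the bounds on \<open>\<phi>\<close>\<close>

lemma norm_GDERIV_abs_compose:
  fixes G :: "'a::real_inner \<Rightarrow> real"
  assumes G: "GDERIV G u :> g" and "G u \<noteq> 0"
    and \<phi>: "(\<phi> has_real_derivative m) (at \<bar>G u\<bar>)"
    and D: "GDERIV (\<lambda>v. \<phi> \<bar>G v\<bar>) u :> D"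
  shows "norm D = \<bar>m\<bar> * norm g"
proof -
  have "((\<lambda>y. \<phi> \<bar>y\<bar>) has_real_derivative m * sgn (G u)) (at (G u))"
    using DERIV_chain2[of \<phi> m abs "G u"] GDERIV_norm[of "G u"] \<phi> assms(2) by simp
  from GDERIV_DERIV_compose[OF G this]
  have "GDERIV (\<lambda>v. \<phi> \<bar>G v\<bar>) u :> (m * sgn (G u)) *\<^sub>R g" .
  with D have "D = (m * sgn (G u)) *\<^sub>R g"
    by (rule gderiv_unique)
  then show ?thesis
    using assms(2) by (simp add: abs_mult abs_sgn_eq)
qed

text \<open>The difference \<open>\<phi> x - 2 * c * sqrt x\<close> is nondecreasing; at 0, where
  \<open>sqrt\<close> is not differentiable, continuity suffices.\<close>

lemma ge_sqrt_if_deriv_ge: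
  fixes \<phi> :: "real \<Rightarrow> real"
  assumes cont: "continuous_on {0..s} \<phi>" and "\<phi> 0 = 0" and s: "0 < s"
    and \<phi>: "\<And>x. 0 < x \<Longrightarrow> x < s \<Longrightarrow> (\<phi> has_real_derivative \<phi>' x) (at x)"
    and ge: "\<And>x. 0 < x \<Longrightarrow> x < s \<Longrightarrow> c / sqrt x \<le> \<phi>' x"
  shows "2 * c * sqrt s \<le> \<phi> s"
proof -
  have "\<phi> 0 - 2 * c * sqrt 0 \<le> \<phi> s - 2 * c * sqrt s"
  proof (rule DERIV_nonneg_imp_increasing_open[of 0 s "\<lambda>x. \<phi> x - 2 * c * sqrt x"])
    fix x assume x: "0 < x" "x < s"
    have "((\<lambda>x. \<phi> x - 2 * c * sqrt x) has_real_derivative \<phi>' x - c / sqrt x) (at x)"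
      using x by (auto intro!: derivative_eq_intros \<phi> simp: field_simps)
    with ge[OF x] show "\<exists>y. ((\<lambda>x. \<phi> x - 2 * c * sqrt x) has_real_derivative y) (at x) \<and> 0 \<le> y"
      by (intro exI conjI) auto
  qed (use s in \<open>auto intro!: continuous_intros cont\<close>)
  then show ?thesis using assms(2) by simp
qed

theorem lemma2p9:
  fixes \<O> :: "nat \<Rightarrow> real list set set"
    and \<Omega> :: "(real ^ 'n::{finite,linorder}) set"
    and G :: "real ^ 'n::{finite,linorder} \<Rightarrow> real"
    and \<phi> :: "real \<Rightarrow> real"
    and \<eta> r\<^sub>0 :: real
  assumes "o_minimal_structure \<O>"
    and "open \<Omega>" and "0 \<in> \<Omega>"
    and "C2_on \<Omega> G" and "definable_on \<O> \<Omega> G"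
    and "G 0 = 0"
    and "nontrivial_critical_point \<Omega> G 0"
    and "0 < \<eta>" and "0 < r\<^sub>0"
    and "desingularizing_function \<Omega> G 0 \<eta> r\<^sub>0 \<phi>"
  shows "\<exists>c>0. \<forall>\<^sub>F s in at_right 0. c / sqrt s \<le> deriv \<phi> s \<and> 2 * c * sqrt s \<le> \<phi> s"
proof -
  note G0 = \<open>G 0 = 0\<close>
  have \<phi>cont: "continuous_on {0..<r\<^sub>0} \<phi>" and \<phi>0: "\<phi> 0 = 0"
    and \<phi>C1: "\<phi> C1_differentiable_on {0<..<r\<^sub>0}"
    and \<phi>pos: "\<And>s. 0 < s \<Longrightarrow> s < r\<^sub>0 \<Longrightarrow> 0 < deriv \<phi> s"
    and \<phi>G: "\<And>u. u \<in> ball 0 \<eta> \<Longrightarrow> G u \<noteq> 0 \<Longrightarrow>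
      \<exists>D. (GDERIV (\<lambda>v. \<phi> \<bar>G v\<bar>) u :> D) \<and> 1 \<le> norm D"
    and small: "\<And>u. u \<in> ball 0 \<eta> \<Longrightarrow> \<bar>G u\<bar> < r\<^sub>0"
    using assms(10) G0 by (auto simp: desingularizing_function_def)
  have \<phi>': "(\<phi> has_real_derivative deriv \<phi> s) (at s)" if s: "0 < s" "s < r\<^sub>0" for s
  proof -
    obtain D where "(\<phi> has_real_derivative D) (at s)"
      using \<phi>C1 s
      by (fastforce simp: C1_differentiable_on_def has_real_derivative_iff_has_vector_derivative)
    then show ?thesis by (simp add: DERIV_imp_deriv)
  qed
  obtain g d L where d: "0 < d" "cball 0 d \<subseteq> \<Omega>" and L: "0 < L"
    and g: "\<And>x. x \<in> \<Omega> \<Longrightarrow> GDERIV G x :> g x"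
    and lip: "\<And>x y. x \<in> cball 0 d \<Longrightarrow> y \<in> cball 0 d \<Longrightarrow> norm (g x - g y) \<le> L * norm (x - y)"
    by (rule C2_on_locally_Lipschitz_gradient[OF assms(4,2,3)]) (rule that)
  have "GDERIV G 0 :> 0"
    using assms(7) by (simp add: nontrivial_critical_point_def crit_def)
  then have g0: "g 0 = 0"
    by (rule gderiv_unique[OF g[OF assms(3)]])
  \<comment> \<open>The closed ball of radius \<open>e\<close> must lie in the Lipschitz ball and in
    the open ball of radius \<open>\<eta>\<close>, hence the half.\<close>
  define e where "e = min d (\<eta> / 2)"
  have e: "0 < e" "e \<le> d" "e < \<eta>"
    using d assms(8) by (auto simp: e_def)
  obtain p where p: "dist 0 p < e" "G p \<noteq> 0"
    using nontrivial_critical_point_nonzero_nearby[OF assms(2,7) e(1)] by blast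
  have contG: "continuous_on (cball 0 e) G"
  proof (intro continuous_at_imp_continuous_on ballI)
    fix x :: "(real, 'n) vec" assume "x \<in> cball 0 e"
    with e d have "x \<in> \<Omega>" by auto
    from g[OF this] show "isCont G x"
      unfolding gderiv_def by (rule has_derivative_continuous)
  qed
  define c where "c = 1 / sqrt (8 * L)"
  have c: "0 < c" using L by (simp add: c_def)
  \<comment> \<open>The value \<open>\<bar>G p\<bar>\<close> bounds the range of \<open>s\<close>:
    below it a level point exists, and \<open>\<phi>\<close> is differentiable.\<close>
  have pr: "\<bar>G p\<bar> < r\<^sub>0" using p e by (intro small) auto
  have deriv_ge: "c / sqrt s \<le> deriv \<phi> s" if s: "0 < s" "s \<le> \<bar>G p\<bar>" for s
  proof -
    obtain u where u: "norm u \<le> e" "\<bar>G u\<bar> = s" "\<And>v. norm v \<le> norm u \<Longrightarrow> \<bar>G v\<bar> \<le> s"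
      using exists_level_point_maximal_on_cball[OF contG G0 _ s(2) s(1)] p by auto
    have mem: "x \<in> cball 0 d" "x \<in> \<Omega>" if "norm x \<le> norm u" for x
    proof -
      show "x \<in> cball 0 d" using that u(1) e(2) by simp
      then show "x \<in> \<Omega>" using d(2) by blast
    qed
    \<comment> \<open>The sign makes the value at \<open>u\<close> equal to \<open>s > 0\<close>, a
      maximum of \<open>\<sigma> * G\<close> on the ball, without changing the norm of the
      gradient.\<close>
    define \<sigma> where "\<sigma> = sgn (G u)"
    have \<sigma>: "\<bar>\<sigma>\<bar> = 1" "\<sigma> * G u = s"
      using u(2) s(1) by (auto simp: \<sigma>_def sgn_if)
    have "(norm (\<sigma> *\<^sub>R g u))\<^sup>2 \<le> 8 * L * (\<sigma> * G u)"
    proof (rule norm_gradient_le_at_max[of u "\<lambda>x. \<sigma> * G x" "\<lambda>x. \<sigma> *\<^sub>R g x"])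
      fix x :: "(real, 'n) vec" assume "norm x \<le> norm u"
      then show "GDERIV (\<lambda>x. \<sigma> * G x) x :> \<sigma> *\<^sub>R g x"
        using g[OF mem(2)] unfolding gderiv_def
        by (auto intro!: derivative_eq_intros)
    next
      fix x y :: "(real, 'n) vec" assume "norm x \<le> norm u" "norm y \<le> norm u"
      then show "norm (\<sigma> *\<^sub>R g x - \<sigma> *\<^sub>R g y) \<le> L * norm (x - y)"
        using lip[OF mem(1) mem(1)] \<sigma> by (simp flip: scaleR_diff_right)
    qed (use L g0 \<sigma> u(3) in \<open>auto simp: abs_mult\<close>)
    then have "(norm (g u))\<^sup>2 \<le> 8 * L * s" using \<sigma> by simp
    then have gu: "norm (g u) \<le> sqrt (8 * L) * sqrt s"
      by (simp add: real_le_rsqrt flip: real_sqrt_mult)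
    have sr: "s < r\<^sub>0" using s pr by simp
    have "u \<in> ball 0 \<eta>" using u(1) e by auto
    moreover have Gu: "G u \<noteq> 0" using u(2) s(1) by auto
    ultimately obtain D where D: "GDERIV (\<lambda>v. \<phi> \<bar>G v\<bar>) u :> D" "1 \<le> norm D"
      using \<phi>G by blast
    \<comment> \<open>Since \<open>\<bar>G u\<bar> = s\<close>, the inequality at \<open>u\<close>
      involves \<open>\<phi>\<close> exactly at \<open>s\<close>.\<close>
    have "1 \<le> deriv \<phi> s * norm (g u)"
      using norm_GDERIV_abs_compose[OF g[OF mem(2)] Gu _ D(1), of "deriv \<phi> s"]
        \<phi>'[OF s(1) sr] \<phi>pos[OF s(1) sr] u(2) D(2) by simp
    also have "\<dots> \<le> deriv \<phi> s * (sqrt (8 * L) * sqrt s)"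
      using gu \<phi>pos[OF s(1) sr] by (intro mult_left_mono) auto
    finally have "1 \<le> deriv \<phi> s * (sqrt (8 * L) * sqrt s)" .
    moreover have "0 < sqrt (8 * L) * sqrt s" using L s by simp
    ultimately show ?thesis
      unfolding c_def divide_divide_eq_left by (simp only: pos_divide_le_eq)
  qed
  have "c / sqrt s \<le> deriv \<phi> s \<and> 2 * c * sqrt s \<le> \<phi> s" if s: "0 < s" "s < \<bar>G p\<bar>" for s
  proof
    show "c / sqrt s \<le> deriv \<phi> s" using s by (intro deriv_ge) auto
    show "2 * c * sqrt s \<le> \<phi> s"
    proof (rule ge_sqrt_if_deriv_ge[where \<phi>' = "deriv \<phi>"])
      show "continuous_on {0..s} \<phi>"
        using s pr by (intro continuous_on_subset[OF \<phi>cont]) auto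
    qed (use s pr \<phi>0 in \<open>auto intro!: \<phi>' deriv_ge\<close>)
  qed
  moreover have "\<forall>\<^sub>F s in at_right 0. 0 < s \<and> s < \<bar>G p\<bar>"
    using p(2) by (auto simp: eventually_at_right_field intro!: exI[of _ "\<bar>G p\<bar>"])
  ultimately show ?thesis
    using c by (intro exI[of _ c]) (auto elim!: eventually_mono)
qed

end
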